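(* Any indecomposable representation of $V_2$ is either isomorphic to one of the representations $\rho_1,\rho_2,\rho_3,\rho_4$ or induced by an indecomposable representation of the quiver $A$ or of the quiver $B$.
   Context: The ground field is $\mathbb{C}$; representations are finite-dimensional. $V_2$ is the following quiver with relations. Its vertices are the four vertices of a square, denoted $11$ (upper left), $12$ (upper right), $21$ (lower left), $22$ (lower right); its arrows are the four edges of the square ($11$–$12$, $12$–$22$, $22$–$21$, $21$–$11$), each taken with both orientations. Placing the square as $\{\pm1\}^2\subset\mathbb{R}^2$, a path is called admissible if each of the two coordinate functions is weakly monotonic along it. Relations: each non-admissible path is zero, and any two admissible paths with the same start and the same end are equal. $\rho_1$ is the representation of $V_2$ with $\mathbb{C}$ at each vertex, in which the arrows $11\to12$, $11\to21$, $12\to22$, $21\to22$ are represented by identity maps and all the reverse arrows by zero maps. $\rho_2,\rho_3,\rho_4$ are obtained from $\rho_1$ by rotating the square by $90^\circ$ one, two, or three times, respectively. $A$ is the quiver (without relations) on the same four vertices with arrows $11\to12$, $11\to21$, $22\to12$, $22\to21$. $B$ is the quiver (without relations) on the same four vertices with arrows $12\to11$, $12\to22$, $21\to11$, $21\to22$. A representation of $A$ or $B$ induces a representation of $V_2$ by representing all the remaining (reverse) arrows of $V_2$ by zero maps. *)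

theory Defs
  imports Complex_Main "Graph_Theory.Graph_Theory"
begin

section \<open>Finite-dimensional complex representations of quivers\<close>

text \<open>
  A quiver is a \<open>pre_digraph\<close>, and its paths are the arc walks \<open>awalk u p v\<close>; the empty arc list
  is the trivial path at \<open>u = v\<close>, and an arc list is traversed from its first entry to its last.

  The spaces of a representation are finite-dimensional subspaces of an arbitrary complex vector
  space with scalar multiplication \<open>s\<close>. Any family of spaces indexed by the vertices can
  be realised in this way inside its direct sum. Arrow maps are total functions,
  but only their values on the space at the tail of the arrow are meaningful.
\<close>

record ('a, 'b, 'v) rep =
  rep_space :: "'a \<Rightarrow> 'v set"
  rep_map :: "'b \<Rightarrow> 'v \<Rightarrow> 'v"

definition finite_dim_subspace :: "(complex \<Rightarrow> 'v::ab_group_add \<Rightarrow> 'v) \<Rightarrow> 'v set \<Rightarrow> bool" where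
  "finite_dim_subspace s U \<longleftrightarrow>
     module.subspace s U \<and> (\<exists>B. finite B \<and> U = module.span s B)"

definition linear_between ::
  "(complex \<Rightarrow> 'v::ab_group_add \<Rightarrow> 'v) \<Rightarrow> (complex \<Rightarrow> 'w::ab_group_add \<Rightarrow> 'w)
    \<Rightarrow> 'v set \<Rightarrow> 'w set \<Rightarrow> ('v \<Rightarrow> 'w) \<Rightarrow> bool" where
  "linear_between s s' U W f \<longleftrightarrow>
     f ` U \<subseteq> W \<and>
     (\<forall>x\<in>U. \<forall>y\<in>U. f (x + y) = f x + f y) \<and>
     (\<forall>c. \<forall>x\<in>U. f (s c x) = s' c (f x))"

definition quiver_rep ::
  "(complex \<Rightarrow> 'v::ab_group_add \<Rightarrow> 'v) \<Rightarrow> ('a, 'b) pre_digraph \<Rightarrow> ('a, 'b, 'v) rep \<Rightarrow> bool" where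
  "quiver_rep s Q R \<longleftrightarrow>
     vector_space s \<and>
     (\<forall>x\<in>verts Q. finite_dim_subspace s (rep_space R x)) \<and>
     (\<forall>a\<in>arcs Q. linear_between s s (rep_space R (tail Q a)) (rep_space R (head Q a)) (rep_map R a))"

definition subrepresentation ::
  "(complex \<Rightarrow> 'v::ab_group_add \<Rightarrow> 'v) \<Rightarrow> ('a, 'b) pre_digraph \<Rightarrow> ('a, 'b, 'v) rep
    \<Rightarrow> ('a \<Rightarrow> 'v set) \<Rightarrow> bool" where
  "subrepresentation s Q R U \<longleftrightarrow>
     (\<forall>x\<in>verts Q. module.subspace s (U x) \<and> U x \<subseteq> rep_space R x) \<and>
     (\<forall>a\<in>arcs Q. rep_map R a ` U (tail Q a) \<subseteq> U (head Q a))"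

definition internal_direct_sum ::
  "('a, 'b) pre_digraph \<Rightarrow> ('a \<Rightarrow> 'v::ab_group_add set) \<Rightarrow> ('a \<Rightarrow> 'v set) \<Rightarrow> ('a \<Rightarrow> 'v set) \<Rightarrow> bool" where
  "internal_direct_sum Q V U W \<longleftrightarrow>
     (\<forall>x\<in>verts Q. V x = {u + w |u w. u \<in> U x \<and> w \<in> W x} \<and> U x \<inter> W x = {0})"

definition zero_family :: "('a, 'b) pre_digraph \<Rightarrow> ('a \<Rightarrow> 'v::zero set) \<Rightarrow> bool" where
  "zero_family Q V \<longleftrightarrow> (\<forall>x\<in>verts Q. V x = {0})"

text \<open>
  Relations are inherited by subrepresentations, so for a quiver with relations indecomposability
  is indecomposability as a representation of the underlying quiver.
\<close>

definition indecomposable ::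
  "(complex \<Rightarrow> 'v::ab_group_add \<Rightarrow> 'v) \<Rightarrow> ('a, 'b) pre_digraph \<Rightarrow> ('a, 'b, 'v) rep \<Rightarrow> bool" where
  "indecomposable s Q R \<longleftrightarrow>
     \<not> zero_family Q (rep_space R) \<and>
     (\<forall>U W. subrepresentation s Q R U \<and> subrepresentation s Q R W \<and>
            internal_direct_sum Q (rep_space R) U W
            \<longrightarrow> zero_family Q U \<or> zero_family Q W)"

definition rep_iso ::
  "('a, 'b) pre_digraph
    \<Rightarrow> (complex \<Rightarrow> 'v::ab_group_add \<Rightarrow> 'v) \<Rightarrow> ('a, 'b, 'v) rep
    \<Rightarrow> (complex \<Rightarrow> 'w::ab_group_add \<Rightarrow> 'w) \<Rightarrow> ('a, 'b, 'w) rep \<Rightarrow> bool" where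
  "rep_iso Q s R s' R' \<longleftrightarrow>
     (\<exists>\<phi>. (\<forall>x\<in>verts Q. linear_between s s' (rep_space R x) (rep_space R' x) (\<phi> x) \<and>
                       bij_betw (\<phi> x) (rep_space R x) (rep_space R' x)) \<and>
          (\<forall>a\<in>arcs Q. \<forall>v\<in>rep_space R (tail Q a).
             \<phi> (head Q a) (rep_map R a v) = rep_map R' a (\<phi> (tail Q a) v)))"

text \<open>Equality of representations, disregarding the irrelevant values of the total functions.\<close>

definition same_rep ::
  "('a, 'b) pre_digraph \<Rightarrow> ('a, 'b, 'v) rep \<Rightarrow> ('a, 'b, 'v) rep \<Rightarrow> bool" where
  "same_rep Q R R' \<longleftrightarrow>
     (\<forall>x\<in>verts Q. rep_space R x = rep_space R' x) \<and>
     (\<forall>a\<in>arcs Q. \<forall>v\<in>rep_space R (tail Q a). rep_map R a v = rep_map R' a v)"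

primrec path_map :: "('a, 'b, 'v) rep \<Rightarrow> 'b awalk \<Rightarrow> 'v \<Rightarrow> 'v" where
  "path_map R [] = id"
| "path_map R (a # p) = path_map R p \<circ> rep_map R a"

section \<open>The quiver with relations on the square\<close>

text \<open>Matrix numbering: the first index is the row, counted from the top.\<close>

datatype square_vertex = V11 | V12 | V21 | V22

fun xcoord :: "square_vertex \<Rightarrow> int" where
  "xcoord V11 = -1" | "xcoord V12 = 1" | "xcoord V21 = -1" | "xcoord V22 = 1"

fun ycoord :: "square_vertex \<Rightarrow> int" where
  "ycoord V11 = 1" | "ycoord V12 = 1" | "ycoord V21 = -1" | "ycoord V22 = -1"

type_synonym square_quiver = "(square_vertex, square_vertex \<times> square_vertex) pre_digraph"
type_synonym 'v square_rep = "(square_vertex, square_vertex \<times> square_vertex, 'v) rep"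

definition quiver_of :: "(square_vertex \<times> square_vertex) set \<Rightarrow> square_quiver" where
  "quiver_of E = \<lparr>verts = UNIV, arcs = E, tail = fst, head = snd\<rparr>"

definition square_edges :: "(square_vertex \<times> square_vertex) set" where
  "square_edges = {(V11, V12), (V12, V22), (V22, V21), (V21, V11)}"

definition quiver_V2 :: square_quiver where
  "quiver_V2 = quiver_of (square_edges \<union> square_edges\<inverse>)"

definition quiver_A :: square_quiver where
  "quiver_A = quiver_of {(V11, V12), (V11, V21), (V22, V12), (V22, V21)}"

definition quiver_B :: square_quiver where
  "quiver_B = quiver_of {(V12, V11), (V12, V22), (V21, V11), (V21, V22)}"

definition weakly_monotonic :: "int list \<Rightarrow> bool" where
  "weakly_monotonic xs \<longleftrightarrow> sorted_wrt (\<le>) xs \<or> sorted_wrt (\<ge>) xs"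

definition admissible :: "square_vertex \<Rightarrow> (square_vertex \<times> square_vertex) awalk \<Rightarrow> bool" where
  "admissible u p \<longleftrightarrow>
     weakly_monotonic (map xcoord (pre_digraph.awalk_verts quiver_V2 u p)) \<and>
     weakly_monotonic (map ycoord (pre_digraph.awalk_verts quiver_V2 u p))"

definition V2_relations :: "'v::zero square_rep \<Rightarrow> bool" where
  "V2_relations R \<longleftrightarrow>
     (\<forall>u p v. pre_digraph.awalk quiver_V2 u p v \<and> \<not> admissible u p
        \<longrightarrow> (\<forall>x\<in>rep_space R u. path_map R p x = 0)) \<and>
     (\<forall>u p q v. pre_digraph.awalk quiver_V2 u p v \<and> pre_digraph.awalk quiver_V2 u q v \<and>
                admissible u p \<and> admissible u q
        \<longrightarrow> (\<forall>x\<in>rep_space R u. path_map R p x = path_map R q x))"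

definition V2_rep :: "(complex \<Rightarrow> 'v::ab_group_add \<Rightarrow> 'v) \<Rightarrow> 'v square_rep \<Rightarrow> bool" where
  "V2_rep s R \<longleftrightarrow> quiver_rep s quiver_V2 R \<and> V2_relations R"

definition rho1 :: "complex square_rep" where
  "rho1 = \<lparr>rep_space = (\<lambda>_. UNIV),
           rep_map = (\<lambda>a. if a \<in> {(V11, V12), (V11, V21), (V12, V22), (V21, V22)}
                          then (\<lambda>z. z) else (\<lambda>_. 0))\<rparr>"

fun clockwise :: "square_vertex \<Rightarrow> square_vertex" where
  "clockwise V11 = V12" | "clockwise V12 = V22" | "clockwise V22 = V21" | "clockwise V21 = V11"

text \<open>
  Reindexing along the clockwise quarter turn moves the representation by a counterclockwise
  quarter turn. The opposite direction gives the same four representations in another order.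
\<close>

definition rotate_rep :: "'v square_rep \<Rightarrow> 'v square_rep" where
  "rotate_rep R = \<lparr>rep_space = (\<lambda>x. rep_space R (clockwise x)),
                   rep_map = (\<lambda>a. rep_map R (map_prod clockwise clockwise a))\<rparr>"

definition rho :: "nat \<Rightarrow> complex square_rep" where
  "rho k = (rotate_rep ^^ (k - 1)) rho1"

definition extend_by_zero :: "square_quiver \<Rightarrow> 'v::zero square_rep \<Rightarrow> 'v square_rep" where
  "extend_by_zero Q S =
     \<lparr>rep_space = rep_space S,
      rep_map = (\<lambda>a. if a \<in> arcs Q then rep_map S a else (\<lambda>_. 0))\<rparr>"

definition induced_by_indecomposable ::
  "(complex \<Rightarrow> 'v::ab_group_add \<Rightarrow> 'v) \<Rightarrow> square_quiver \<Rightarrow> 'v square_rep \<Rightarrow> bool" where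
  "induced_by_indecomposable s Q R \<longleftrightarrow>
     (\<exists>S. quiver_rep s Q S \<and> indecomposable s Q S \<and>
          same_rep quiver_V2 R (extend_by_zero Q S))"

end

theory Submission
  imports Defs
begin

text \<open>
  Write \<open>h\<close> and \<open>v\<close> for the total horizontal and vertical arrow maps on the direct sum of the four
  spaces. The relations say exactly that \<open>h\<^sup>2 = v\<^sup>2 = 0\<close> and \<open>hv = vh\<close>: going back and forth along
  an edge is inadmissible, and the two ways round to the opposite corner are both admissible.
  (Every path of length three or more contains, up to commutation, a repeated letter.) A representation of
  the square is therefore a graded module over the Frobenius algebra
  \<open>\<complex>[h, v]/(h\<^sup>2, v\<^sup>2)\<close>, graded by the Klein four-group of corners, with socle spanned by \<open>hv\<close>.

  If \<open>hv\<close> is nonzero on some vector \<open>x\<close> at a corner \<open>g\<close>, then \<open>x\<close> generates a free submodule with basis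
  \<open>x, hx, vx, hvx\<close>. Free modules over a Frobenius algebra are injective, so this submodule splits off;
  concretely, a linear functional that is \<open>1\<close> on \<open>hvx\<close> is pulled back along the paths from each corner
  to the corner opposite to \<open>g\<close>, and the kernels of these four functionals form a complement
  (\<open>indecomposable_iso_of_retract\<close>, \<open>diagonal_nonzero_imp_iso_rho\<close>). Indecomposability makes
  the complement zero, and the four functionals are then the isomorphism onto a rotation of \<open>\<rho>\<^sub>1\<close>.

  If \<open>hv = 0\<close>, all arrows kill the image \<open>I = hM + vM\<close> inside the module \<open>M\<close>. Choose a complement \<open>C\<close> of \<open>I\<close> at every
  corner. Arrows lead from \<open>C\<close> at one corner to \<open>I\<close> at a neighbouring one and vanish on \<open>I\<close>. Since the
  square is bipartite, the module is the direct sum of two submodules: \<open>C\<close> at one pair of opposite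
  corners with \<open>I\<close> at the other pair, and the same with the pairs exchanged
  (\<open>diagonals_zero_imp_half_vanishing\<close>). One of the two is zero, so all arrows starting from
  one pair of opposite corners vanish, and what is left is a representation of \<open>A\<close> or of \<open>B\<close>.
\<close>

section \<open>The square as a graded module\<close>

fun hflip :: "square_vertex \<Rightarrow> square_vertex" where
  "hflip V11 = V12" | "hflip V12 = V11" | "hflip V21 = V22" | "hflip V22 = V21"

fun vflip :: "square_vertex \<Rightarrow> square_vertex" where
  "vflip V11 = V21" | "vflip V21 = V11" | "vflip V12 = V22" | "vflip V22 = V12"

lemma hflip_hflip [simp]: "hflip (hflip u) = u"
  by (cases u) auto

lemma vflip_vflip [simp]: "vflip (vflip u) = u"
  by (cases u) auto

lemma vflip_hflip [simp]: "vflip (hflip u) = hflip (vflip u)"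
  by (cases u) auto

lemma flips_distinct [simp]:
  "hflip u \<noteq> u" "vflip u \<noteq> u" "hflip (vflip u) \<noteq> u" "hflip u \<noteq> vflip u"
  "u \<noteq> hflip u" "u \<noteq> vflip u" "u \<noteq> hflip (vflip u)" "vflip u \<noteq> hflip u"
  by (cases u; simp)+

lemma flip_eq_iff [simp]:
  "hflip u = hflip w \<longleftrightarrow> u = w" "vflip u = vflip w \<longleftrightarrow> u = w"
  by (metis hflip_hflip) (metis vflip_vflip)

lemma vertex_cases:
  obtains "u = g" | "u = hflip g" | "u = vflip g" | "u = hflip (vflip g)"
  by (cases u; cases g) auto

lemma verts_V2 [simp]: "verts quiver_V2 = UNIV"
  by (simp add: quiver_V2_def quiver_of_def)

lemma tail_V2 [simp]: "tail quiver_V2 = fst"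
  by (simp add: quiver_V2_def quiver_of_def)

lemma head_V2 [simp]: "head quiver_V2 = snd"
  by (simp add: quiver_V2_def quiver_of_def)

lemma arcs_V2: "(u, w) \<in> arcs quiver_V2 \<longleftrightarrow> w = hflip u \<or> w = vflip u"
  by (cases u; cases w) (auto simp: quiver_V2_def quiver_of_def square_edges_def)

lemma awalk_two_arcs:
  assumes "(u, w) \<in> arcs quiver_V2" "(w, z) \<in> arcs quiver_V2"
  shows "pre_digraph.awalk quiver_V2 u [(u, w), (w, z)] z"
  using assms by (simp add: pre_digraph.awalk_def pre_digraph.cas.simps)

lemma admissible_two_arcs:
  "admissible u [(u, w), (w, z)] \<longleftrightarrow>
     weakly_monotonic [xcoord u, xcoord w, xcoord z] \<and>
     weakly_monotonic [ycoord u, ycoord w, ycoord z]"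
  by (simp add: admissible_def pre_digraph.awalk_verts.simps)

definition forward_arcs :: "square_vertex \<Rightarrow> (square_vertex \<times> square_vertex) set" where
  "forward_arcs g = {(g, hflip g), (g, vflip g),
     (hflip g, hflip (vflip g)), (vflip g, hflip (vflip g))}"

text \<open>
  The list \<open>\<rho>\<^sub>1, \<dots>, \<rho>\<^sub>4\<close> is indexed here by the corner from which the arrows with nonzero map lead away,
  so that the argument can treat an arbitrary corner instead of four cases.
\<close>

lemma rho_from_vertex:
  obtains k where "k \<in> {1..4}" "rep_space (rho k) = (\<lambda>_. UNIV)"
    "rep_map (rho k) = (\<lambda>a. if a \<in> forward_arcs g then (\<lambda>z. z) else (\<lambda>_. 0))"
proof -
  have cw: "clockwise u = V11 \<longleftrightarrow> u = V21" "clockwise u = V12 \<longleftrightarrow> u = V11"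
    "clockwise u = V22 \<longleftrightarrow> u = V12" "clockwise u = V21 \<longleftrightarrow> u = V22" for u
    by (cases u; simp)+
  \<comment> \<open>Each application of \<open>rotate_rep\<close> moves the starting corner one step counterclockwise.\<close>
  define k :: nat where "k = (case g of V11 \<Rightarrow> 1 | V21 \<Rightarrow> 2 | V22 \<Rightarrow> 3 | V12 \<Rightarrow> 4)"
  have "k \<in> {1..4}"
    by (cases g) (auto simp: k_def)
  moreover have "rep_space (rho k) = (\<lambda>_. UNIV)"
    by (cases g) (auto simp: k_def rho_def rotate_rep_def rho1_def numeral_eq_Suc)
  moreover have
    "rep_map (rho k) = (\<lambda>a. if a \<in> forward_arcs g then (\<lambda>z. z) else (\<lambda>_. 0))"
    by (cases g) (auto simp: k_def rho_def rotate_rep_def rho1_def numeral_eq_Suc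
        forward_arcs_def fun_eq_iff cw)
  ultimately show ?thesis by (rule that)
qed

text \<open>
  The path relations enter the argument only through \<open>arrow_back\<close> and \<open>square_commutes\<close>,
  which are \<open>h\<^sup>2 = v\<^sup>2 = 0\<close> and \<open>hv = vh\<close>.
\<close>

locale V2_representation =
  fixes s :: "complex \<Rightarrow> 'v::ab_group_add \<Rightarrow> 'v" and R :: "'v square_rep"
  assumes V2_rep: "V2_rep s R"

sublocale V2_representation \<subseteq> vector_space s
  using V2_rep by (simp add: V2_rep_def quiver_rep_def)

context V2_representation
begin

abbreviation V :: "square_vertex \<Rightarrow> 'v set" where
  "V \<equiv> rep_space R"

lemma subspace_V: "subspace (V u)"
  using V2_rep by (simp add: V2_rep_def quiver_rep_def finite_dim_subspace_def)

lemma zero_in_V [simp]: "0 \<in> V u"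
  using subspace_V by (rule subspace_0)

lemma linear_arrow:
  assumes "(u, w) \<in> arcs quiver_V2"
  shows "linear_between s s (V u) (V w) (rep_map R (u, w))"
  using V2_rep assms by (force simp: V2_rep_def quiver_rep_def)

lemma
  assumes "(u, w) \<in> arcs quiver_V2"
  shows arrow_in [simp]: "y \<in> V u \<Longrightarrow> rep_map R (u, w) y \<in> V w"
    and arrow_add [simp]: "y \<in> V u \<Longrightarrow> z \<in> V u \<Longrightarrow>
      rep_map R (u, w) (y + z) = rep_map R (u, w) y + rep_map R (u, w) z"
    and arrow_scale [simp]: "y \<in> V u \<Longrightarrow> rep_map R (u, w) (s c y) = s c (rep_map R (u, w) y)"
  using linear_arrow[OF assms] by (auto simp: linear_between_def)

lemma arrow_zero [simp]:
  assumes "(u, w) \<in> arcs quiver_V2"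
  shows "rep_map R (u, w) 0 = 0"
  using arrow_scale[OF assms, of 0 0] by simp

lemma arrow_back [simp]:
  assumes arc: "(u, w) \<in> arcs quiver_V2" and y: "y \<in> V u"
  shows "rep_map R (w, u) (rep_map R (u, w) y) = 0"
proof -
  have arc': "(w, u) \<in> arcs quiver_V2"
    using arc by (auto simp: arcs_V2)
  have "\<not> admissible u [(u, w), (w, u)]"
  proof -
    have "w = hflip u \<or> w = vflip u"
      using arc by (simp add: arcs_V2)
    then show ?thesis
      by (elim disjE; cases u; simp add: admissible_two_arcs weakly_monotonic_def)
  qed
  then have "path_map R [(u, w), (w, u)] y = 0"
    using V2_rep awalk_two_arcs[OF arc arc'] y
    unfolding V2_rep_def V2_relations_def by blast
  then show ?thesis by simp
qed

lemma square_commutes: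
  assumes "y \<in> V u"
  shows "rep_map R (hflip u, hflip (vflip u)) (rep_map R (u, hflip u) y) =
    rep_map R (vflip u, hflip (vflip u)) (rep_map R (u, vflip u) y)"
proof -
  let ?p = "[(u, hflip u), (hflip u, hflip (vflip u))]"
  let ?q = "[(u, vflip u), (vflip u, hflip (vflip u))]"
  have "pre_digraph.awalk quiver_V2 u ?p (hflip (vflip u))"
    "pre_digraph.awalk quiver_V2 u ?q (hflip (vflip u))"
    by (rule awalk_two_arcs; simp add: arcs_V2)+
  moreover have "admissible u ?p" "admissible u ?q"
    by (cases u; simp add: admissible_two_arcs weakly_monotonic_def)+
  ultimately have "path_map R ?p y = path_map R ?q y"
    using V2_rep assms unfolding V2_rep_def V2_relations_def by blast
  then show ?thesis by simp
qed

section \<open>Splitting off a free summand\<close>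

lemma exists_functional:
  assumes "z \<noteq> 0"
  obtains \<phi> :: "'v \<Rightarrow> complex"
    where "\<And>x y. \<phi> (x + y) = \<phi> x + \<phi> y" "\<And>c x. \<phi> (s c x) = c * \<phi> x" "\<phi> z = 1"
proof -
  interpret pair: vector_space_pair s "(*) :: complex \<Rightarrow> complex \<Rightarrow> complex"
    by unfold_locales (simp_all add: algebra_simps)
  obtain \<phi> where l: "Vector_Spaces.linear s (*) \<phi>" and 1: "\<phi> z = 1"
    using pair.linear_independent_extend[of "{z}" "\<lambda>_. 1"] assms by auto
  interpret Vector_Spaces.linear s "(*)" \<phi> by (rule l)
  show ?thesis using that[of \<phi>] add scale 1 by simp
qed

text \<open>
  The functionals \<open>\<psi>\<close> form a homomorphism from \<open>R\<close> to the thin representation \<open>R'\<close>, and the vectors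
  \<open>gen\<close> are the images of the basis vectors under a homomorphism in the other direction. The
  composition on \<open>R'\<close> is the identity, so \<open>R\<close> is the direct sum of a copy of \<open>R'\<close>, here \<open>L\<close>, and of
  the kernel \<open>K\<close> of \<open>\<psi>\<close>. Indecomposability leaves \<open>K = 0\<close>, which makes \<open>\<psi>\<close> an isomorphism.
\<close>

lemma indecomposable_iso_of_retract:
  fixes \<psi> :: "square_vertex \<Rightarrow> 'v \<Rightarrow> complex" and R' :: "complex square_rep"
  assumes indec: "indecomposable s quiver_V2 R"
    and add: "\<And>u y z. y \<in> V u \<Longrightarrow> z \<in> V u \<Longrightarrow> \<psi> u (y + z) = \<psi> u y + \<psi> u z"
    and scale: "\<And>u c y. y \<in> V u \<Longrightarrow> \<psi> u (s c y) = c * \<psi> u y"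
    and gen_in: "\<And>u. gen u \<in> V u"
    and gen: "\<And>u. \<psi> u (gen u) = 1"
    and R': "rep_space R' = (\<lambda>_. UNIV)"
      "rep_map R' = (\<lambda>a. if a \<in> F then (\<lambda>z. z) else (\<lambda>_. 0))"
    and \<psi>_arrow: "\<And>u w y. (u, w) \<in> arcs quiver_V2 \<Longrightarrow> y \<in> V u \<Longrightarrow>
      \<psi> w (rep_map R (u, w) y) = (if (u, w) \<in> F then \<psi> u y else 0)"
    and gen_arrow: "\<And>u w. (u, w) \<in> arcs quiver_V2 \<Longrightarrow>
      rep_map R (u, w) (gen u) = (if (u, w) \<in> F then gen w else 0)"
  shows "rep_iso quiver_V2 s R (*) R'"
proof -
  define L where "L u = range (\<lambda>c. s c (gen u))" for u
  define K where "K u = {y \<in> V u. \<psi> u y = 0}" for u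
  have \<psi>_zero [simp]: "\<psi> u 0 = 0" for u
    using scale[of 0 u 0] by simp
  have sub_L: "subrepresentation s quiver_V2 R L"
    unfolding subrepresentation_def
  proof (intro conjI ballI)
    fix u
    show "subspace (L u)"
      unfolding L_def span_singleton[symmetric] by (rule subspace_span)
    show "L u \<subseteq> V u"
      using gen_in subspace_V by (auto simp: L_def intro: subspace_scale)
  next
    fix a assume a: "a \<in> arcs quiver_V2"
    obtain u w where [simp]: "a = (u, w)" by (cases a)
    have "rep_map R (u, w) (s c (gen u)) \<in> L w" for c
    proof -
      have "rep_map R (u, w) (s c (gen u)) = s (if (u, w) \<in> F then c else 0) (gen w)"
        using a gen_arrow[of u w] gen_in[of u] by simp
      then show ?thesis unfolding L_def by (metis rangeI)
    qed
    then show "rep_map R a ` L (tail quiver_V2 a) \<subseteq> L (head quiver_V2 a)"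
      by (auto simp: L_def)
  qed
  have sub_K: "subrepresentation s quiver_V2 R K"
    unfolding subrepresentation_def
  proof (intro conjI ballI)
    fix u
    show "subspace (K u)"
      using subspace_V[of u] add scale
      by (auto simp: K_def subspace_def)
    show "K u \<subseteq> V u" by (auto simp: K_def)
  next
    fix a assume a: "a \<in> arcs quiver_V2"
    then show "rep_map R a ` K (tail quiver_V2 a) \<subseteq> K (head quiver_V2 a)"
      using \<psi>_arrow by (cases a) (auto simp: K_def)
  qed
  have split: "internal_direct_sum quiver_V2 V L K"
    unfolding internal_direct_sum_def
  proof (intro ballI conjI)
    fix u
    show "V u = {a + b |a b. a \<in> L u \<and> b \<in> K u}" (is "_ = ?S")
    proof
      show "V u \<subseteq> ?S"
      proof
        fix y assume y: "y \<in> V u"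
        let ?a = "s (\<psi> u y) (gen u)"
        have a: "?a \<in> V u" "y - ?a \<in> V u"
          using y gen_in subspace_V by (auto intro: subspace_scale subspace_diff)
        have "\<psi> u (?a + (y - ?a)) = \<psi> u ?a + \<psi> u (y - ?a)"
          using add[OF a] .
        moreover have "\<psi> u ?a = \<psi> u y"
          using scale[OF gen_in] gen by simp
        ultimately have "\<psi> u (y - ?a) = 0" by simp
        then have "y = ?a + (y - ?a) \<and> ?a \<in> L u \<and> y - ?a \<in> K u"
          using a by (auto simp: L_def K_def)
        then show "y \<in> ?S" by blast
      qed
      show "?S \<subseteq> V u"
        using gen_in subspace_V by (auto simp: L_def K_def intro: subspace_add subspace_scale)
    qed
    have "y = 0" if "y \<in> L u" "y \<in> K u" for y
      using that scale[OF gen_in] gen by (auto simp: L_def K_def)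
    moreover have "0 \<in> L u" "0 \<in> K u"
      by (auto simp: L_def K_def intro: range_eqI[of _ _ 0])
    ultimately show "L u \<inter> K u = {0}" by blast
  qed
  have "gen u \<in> L u" "gen u \<noteq> 0" for u
    using gen[of u] by (auto simp: L_def intro: range_eqI[of _ _ 1])
  then have "\<not> zero_family quiver_V2 L"
    unfolding zero_family_def by (metis UNIV_I singletonD verts_V2)
  then have "zero_family quiver_V2 K"
    using indec sub_L sub_K split unfolding indecomposable_def by blast
  then have ker: "y = 0" if "y \<in> V u" "\<psi> u y = 0" for u y
    using that by (auto simp: zero_family_def K_def)
  have inj: "inj_on (\<psi> u) (V u)" for u
  proof (rule inj_onI)
    fix y z assume yz: "y \<in> V u" "z \<in> V u" "\<psi> u y = \<psi> u z"
    have yz': "y - z \<in> V u"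
      using yz subspace_diff[OF subspace_V] by blast
    have "\<psi> u (y - z) = 0"
      using add[OF yz' yz(2)] yz(3) by simp
    then show "y = z"
      using ker[OF yz'] by simp
  qed
  have surj: "\<psi> u ` V u = UNIV" for u
  proof -
    have "c \<in> \<psi> u ` V u" for c
      using scale[OF gen_in, of u c] gen subspace_scale[OF subspace_V gen_in]
      by (metis imageI mult.right_neutral)
    then show ?thesis by auto
  qed
  show ?thesis
    unfolding rep_iso_def
    using add scale inj surj \<psi>_arrow
    by (intro exI[of _ \<psi>]) (auto simp: R' linear_between_def bij_betw_def)
qed

text \<open>
  The retraction onto the free summand: \<open>gen\<close> transports \<open>x\<close> from \<open>g\<close> along forward paths, and \<open>\<psi>\<close>
  transports each vector forwards to the corner opposite to \<open>g\<close> and applies \<open>\<phi>\<close> there. Forward arrows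
  are respected because the square commutes; backward arrows become zero because continuing
  forwards to the opposite corner repeats \<open>h\<close> or \<open>v\<close>.
\<close>

lemma diagonal_nonzero_imp_iso_rho:
  assumes indec: "indecomposable s quiver_V2 R"
    and x: "x \<in> V g"
    and nz: "rep_map R (hflip g, hflip (vflip g)) (rep_map R (g, hflip g) x) \<noteq> 0"
  shows "\<exists>k\<in>{1..4}. rep_iso quiver_V2 s R (*) (rho k)"
proof -
  let ?h = "rep_map R (g, hflip g)" and ?h' = "rep_map R (vflip g, hflip (vflip g))"
  let ?v = "rep_map R (g, vflip g)" and ?v' = "rep_map R (hflip g, hflip (vflip g))"
  note [simp] = arcs_V2
  obtain \<phi> :: "'v \<Rightarrow> complex" where \<phi>: "\<And>x y. \<phi> (x + y) = \<phi> x + \<phi> y"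
    "\<And>c x. \<phi> (s c x) = c * \<phi> x" "\<phi> (?v' (?h x)) = 1"
    using exists_functional[OF nz] by blast
  have \<phi>_zero: "\<phi> 0 = 0"
    using \<phi>(1)[of 0 0] by simp
  define \<psi> where "\<psi> u y =
    (if u = g then \<phi> (?v' (?h y)) else if u = hflip g then \<phi> (?v' y)
     else if u = vflip g then \<phi> (?h' y) else \<phi> y)" for u y
  define gen where "gen u =
    (if u = g then x else if u = hflip g then ?h x
     else if u = vflip g then ?v x else ?v' (?h x))" for u
  obtain k where k: "k \<in> {1..4}" "rep_space (rho k) = (\<lambda>_. UNIV)"
    "rep_map (rho k) = (\<lambda>a. if a \<in> forward_arcs g then (\<lambda>z. z) else (\<lambda>_. 0))"
    using rho_from_vertex[of g] .
  have "rep_iso quiver_V2 s R (*) (rho k)"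
  proof (rule indecomposable_iso_of_retract[OF indec _ _ _ _ k(2,3), of \<psi> gen])
    fix u y z assume "y \<in> V u" "z \<in> V u"
    then show "\<psi> u (y + z) = \<psi> u y + \<psi> u z"
      by (auto simp: \<psi>_def \<phi>)
  next
    fix u c y assume "y \<in> V u"
    then show "\<psi> u (s c y) = c * \<psi> u y"
      by (auto simp: \<psi>_def \<phi>)
  next
    fix u
    show "gen u \<in> V u"
      using x by (cases u g rule: vertex_cases) (auto simp: gen_def)
    show "\<psi> u (gen u) = 1"
      using \<phi>(3) square_commutes[OF x]
      by (cases u g rule: vertex_cases) (auto simp: gen_def \<psi>_def)
  next
    fix u w y assume "(u, w) \<in> arcs quiver_V2" and y: "y \<in> V u"
    then consider "w = hflip u" | "w = vflip u" by auto
    then show "\<psi> w (rep_map R (u, w) y) = (if (u, w) \<in> forward_arcs g then \<psi> u y else 0)"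
    proof cases
      case 1
      then show ?thesis
        using y
        by (cases u g rule: vertex_cases) (auto simp: \<psi>_def forward_arcs_def \<phi>_zero)
    next
      case 2
      \<comment> \<open>The forward path in \<open>\<psi>\<close> starts horizontally, so commuting is needed to expose \<open>v\<^sup>2 = 0\<close>.\<close>
      have "\<phi> (?v' (?h (rep_map R (vflip g, g) y))) = 0" if "u = vflip g"
        using y that square_commutes[of "rep_map R (vflip g, g) y" g] by (simp add: \<phi>_zero)
      with 2 show ?thesis
        using y square_commutes[of y g]
        by (cases u g rule: vertex_cases) (auto simp: \<psi>_def forward_arcs_def \<phi>_zero)
    qed
  next
    fix u w assume "(u, w) \<in> arcs quiver_V2"
    then consider "w = hflip u" | "w = vflip u" by auto
    then show "rep_map R (u, w) (gen u) = (if (u, w) \<in> forward_arcs g then gen w else 0)"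
    proof cases
      case 1
      have "rep_map R (hflip (vflip g), vflip g) (?v' (?h x)) = 0"
        using x square_commutes[OF x] by simp
      with 1 show ?thesis
        using x square_commutes[OF x, symmetric]
        by (cases u g rule: vertex_cases) (auto simp: gen_def forward_arcs_def)
    next
      case 2
      then show ?thesis
        using x
        by (cases u g rule: vertex_cases) (auto simp: gen_def forward_arcs_def)
    qed
  qed
  with k(1) show ?thesis by blast
qed

section \<open>Square-zero radical\<close>

text \<open>A linear projection onto \<open>U\<close> exists, and its kernel within \<open>W\<close> is the complement.\<close>

lemma exists_complement:
  assumes "subspace U" "subspace W" "U \<subseteq> W"
  shows "\<exists>C. subspace C \<and> C \<subseteq> W \<and> W = {u + c |u c. u \<in> U \<and> c \<in> C} \<and> U \<inter> C = {0}"
proof -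
  interpret pair: vector_space_pair s s ..
  obtain p where p: "p ` UNIV \<subseteq> U" "Vector_Spaces.linear s s p" "\<forall>u\<in>U. p u = u"
    using pair.linear_exists_left_inverse_on[OF linear_id assms(1)]
    by auto
  interpret p: Vector_Spaces.linear s s p by (rule p(2))
  define C where "C = {w \<in> W. p w = 0}"
  show ?thesis
  proof (intro exI conjI)
    show "subspace C"
      using assms(2) by (auto simp: C_def subspace_def p.add p.scale p.zero)
    show "C \<subseteq> W" by (auto simp: C_def)
    show "U \<inter> C = {0}"
      using p(3) assms(1,2) by (auto simp: C_def subspace_0 p.zero)
    show "W = {u + c |u c. u \<in> U \<and> c \<in> C}" (is "_ = ?S")
    proof
      show "W \<subseteq> ?S"
      proof
        fix w assume w: "w \<in> W"
        have "p w \<in> U" using p(1) by auto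
        then have "w - p w \<in> C"
          using w assms p(3) by (auto simp: C_def p.diff intro: subspace_diff)
        then have "w = p w + (w - p w) \<and> p w \<in> U \<and> w - p w \<in> C"
          using \<open>p w \<in> U\<close> by simp
        then show "w \<in> ?S" by blast
      qed
      show "?S \<subseteq> W"
        using assms by (auto simp: C_def intro: subspace_add)
    qed
  qed
qed

text \<open>
  Arrows outside \<open>E\<close> act by zero and so preserve every family of subspaces: \<open>R\<close> has the same
  subrepresentations over the square as over the quiver with arrow set \<open>E\<close>, and hence the same decompositions.
\<close>

lemma induced_if_zero_outside:
  assumes indec: "indecomposable s quiver_V2 R"
    and E: "E \<subseteq> arcs quiver_V2"
    and zero: "\<And>u w y. (u, w) \<in> arcs quiver_V2 - E \<Longrightarrow> y \<in> V u \<Longrightarrow> rep_map R (u, w) y = 0"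
  shows "induced_by_indecomposable s (quiver_of E) R"
proof -
  have Q [simp]: "verts (quiver_of E) = UNIV" "arcs (quiver_of E) = E"
    "tail (quiver_of E) = fst" "head (quiver_of E) = snd"
    by (simp_all add: quiver_of_def)
  have "quiver_rep s (quiver_of E) R"
    using V2_rep E by (auto simp: V2_rep_def quiver_rep_def)
  moreover have "subrepresentation s quiver_V2 R U"
    if U: "subrepresentation s (quiver_of E) R U" for U
    unfolding subrepresentation_def
  proof (intro conjI ballI)
    fix u
    show "subspace (U u)" "U u \<subseteq> V u"
      using U by (auto simp: subrepresentation_def)
  next
    fix a assume a: "a \<in> arcs quiver_V2"
    show "rep_map R a ` U (tail quiver_V2 a) \<subseteq> U (head quiver_V2 a)"
    proof (cases "a \<in> E")
      case True
      then show ?thesis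
        using U by (simp add: subrepresentation_def)
    next
      case False
      have "rep_map R a y = 0" if "y \<in> U (fst a)" for y
        using zero[of "fst a" "snd a" y] a False U that by (auto simp: subrepresentation_def)
      moreover have "0 \<in> U (snd a)"
        using U by (auto simp: subrepresentation_def subspace_0)
      ultimately show ?thesis by auto
    qed
  qed
  then have "indecomposable s (quiver_of E) R"
    using indec unfolding indecomposable_def zero_family_def internal_direct_sum_def
    by simp
  moreover have "same_rep quiver_V2 R (extend_by_zero (quiver_of E) R)"
    using zero by (auto simp: same_rep_def extend_by_zero_def)
  ultimately show ?thesis
    unfolding induced_by_indecomposable_def by blast
qed

definition image_space :: "square_vertex \<Rightarrow> 'v set" where
  "image_space u = {rep_map R (hflip u, u) y + rep_map R (vflip u, u) z |y z.
     y \<in> V (hflip u) \<and> z \<in> V (vflip u)}"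

lemma image_space_subset: "image_space u \<subseteq> V u"
  using subspace_V by (auto simp: image_space_def arcs_V2 intro!: subspace_add)

lemma subspace_image_space: "subspace (image_space u)"
proof -
  have h: "(hflip u, u) \<in> arcs quiver_V2" and v: "(vflip u, u) \<in> arcs quiver_V2"
    by (simp_all add: arcs_V2)
  let ?h = "rep_map R (hflip u, u)" and ?v = "rep_map R (vflip u, u)"
  show "subspace (image_space u)"
  proof (rule subspaceI)
    have "0 = ?h 0 + ?v 0" using h v by simp
    then show "0 \<in> image_space u" unfolding image_space_def using zero_in_V by blast
  next
    fix a b assume "a \<in> image_space u" "b \<in> image_space u"
    then obtain y z y' z' where yz: "y \<in> V (hflip u)" "z \<in> V (vflip u)" "a = ?h y + ?v z"
      "y' \<in> V (hflip u)" "z' \<in> V (vflip u)" "b = ?h y' + ?v z'"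
      by (auto simp: image_space_def)
    then have "a + b = ?h (y + y') + ?v (z + z')"
      using h v by (simp add: ac_simps)
    moreover have "y + y' \<in> V (hflip u)" "z + z' \<in> V (vflip u)"
      using yz subspace_add[OF subspace_V] by blast+
    ultimately show "a + b \<in> image_space u" unfolding image_space_def by blast
  next
    fix c a assume "a \<in> image_space u"
    then obtain y z where yz: "y \<in> V (hflip u)" "z \<in> V (vflip u)" "a = ?h y + ?v z"
      by (auto simp: image_space_def)
    then have "s c a = ?h (s c y) + ?v (s c z)"
      using h v by (simp add: scale_right_distrib)
    moreover have "s c y \<in> V (hflip u)" "s c z \<in> V (vflip u)"
      using yz subspace_scale[OF subspace_V] by blast+
    ultimately show "s c a \<in> image_space u" unfolding image_space_def by blast
  qed
qed

lemma arrow_in_image_space: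
  assumes arc: "(u, w) \<in> arcs quiver_V2" and y: "y \<in> V u"
  shows "rep_map R (u, w) y \<in> image_space w"
proof -
  consider "w = hflip u" | "w = vflip u" using arc by (auto simp: arcs_V2)
  then show ?thesis
  proof cases
    case 1
    then have "rep_map R (u, w) y = rep_map R (hflip w, w) y + rep_map R (vflip w, w) 0"
      by (simp add: arcs_V2)
    moreover have "y \<in> V (hflip w)" using 1 y by simp
    ultimately show ?thesis unfolding image_space_def using zero_in_V by blast
  next
    case 2
    then have "rep_map R (u, w) y = rep_map R (hflip w, w) 0 + rep_map R (vflip w, w) y"
      by (simp add: arcs_V2)
    moreover have "y \<in> V (vflip w)" using 2 y by simp
    ultimately show ?thesis unfolding image_space_def using zero_in_V by blast
  qed
qed

lemma arrow_kills_image_space: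
  assumes diag: "\<And>u y. y \<in> V u \<Longrightarrow>
      rep_map R (hflip u, hflip (vflip u)) (rep_map R (u, hflip u) y) = 0"
    and arc: "(u, w) \<in> arcs quiver_V2" and x: "x \<in> image_space u"
  shows "rep_map R (u, w) x = 0"
proof -
  obtain y z where yz: "y \<in> V (hflip u)" "z \<in> V (vflip u)"
    "x = rep_map R (hflip u, u) y + rep_map R (vflip u, u) z"
    using x by (auto simp: image_space_def)
  have "rep_map R (u, vflip u) (rep_map R (hflip u, u) y) = 0"
    using diag[OF yz(1)] by simp
  moreover have "rep_map R (u, hflip u) (rep_map R (vflip u, u) z) = 0"
    using diag[OF yz(2)] square_commutes[OF yz(2)] by simp
  ultimately show ?thesis
    using arc yz arrow_back[of "hflip u" u y] arrow_back[of "vflip u" u z]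
    by (auto simp: arcs_V2)
qed

text \<open>
  The set \<open>T\<close> is one part of the bipartition of the square. The two summands are \<open>P T\<close> and
  \<open>P (- T)\<close>. If \<open>P X\<close> is zero, then the space at each corner in \<open>X\<close> is all image, and
  every arrow that leaves it is zero.
\<close>

lemma diagonals_zero_imp_half_vanishing:
  assumes indec: "indecomposable s quiver_V2 R"
    and diag: "\<And>u y. y \<in> V u \<Longrightarrow>
      rep_map R (hflip u, hflip (vflip u)) (rep_map R (u, hflip u) y) = 0"
    and T: "\<And>u. hflip u \<in> T \<longleftrightarrow> u \<notin> T" "\<And>u. vflip u \<in> T \<longleftrightarrow> u \<notin> T"
  shows "(\<forall>u w y. (u, w) \<in> arcs quiver_V2 \<longrightarrow> u \<in> T \<longrightarrow> y \<in> V u \<longrightarrow> rep_map R (u, w) y = 0) \<or>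
    (\<forall>u w y. (u, w) \<in> arcs quiver_V2 \<longrightarrow> u \<notin> T \<longrightarrow> y \<in> V u \<longrightarrow> rep_map R (u, w) y = 0)"
proof -
  have kill: "rep_map R (u, w) x = 0" if "(u, w) \<in> arcs quiver_V2" "x \<in> image_space u" for u w x
    by (rule arrow_kills_image_space[OF _ that]) (rule diag)
  have "\<forall>u. \<exists>C. subspace C \<and> C \<subseteq> V u \<and>
      V u = {a + c |a c. a \<in> image_space u \<and> c \<in> C} \<and> image_space u \<inter> C = {0}"
    using exists_complement[OF subspace_image_space subspace_V image_space_subset] by blast
  from choice[OF this] obtain C where C: "\<And>u. subspace (C u)" "\<And>u. C u \<subseteq> V u"
    "\<And>u. V u = {a + c |a c. a \<in> image_space u \<and> c \<in> C u}" "\<And>u. image_space u \<inter> C u = {0}"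
    by blast
  define P where "P X u = (if u \<in> X then C u else image_space u)" for X u
  have P_sub: "subrepresentation s quiver_V2 R (P X)"
    if X: "\<And>u w. (u, w) \<in> arcs quiver_V2 \<Longrightarrow> w \<in> X \<longleftrightarrow> u \<notin> X" for X
    unfolding subrepresentation_def
  proof (intro conjI ballI)
    fix u
    show "subspace (P X u)" "P X u \<subseteq> V u"
      using C(1,2) subspace_image_space image_space_subset by (simp_all add: P_def)
  next
    fix a assume a: "a \<in> arcs quiver_V2"
    obtain u w where uw: "a = (u, w)" by (cases a)
    have "rep_map R (u, w) y \<in> P X w" if y: "y \<in> P X u" for y
    proof (cases "u \<in> X")
      case True
      then have "w \<notin> X" "y \<in> V u"
        using X[of u w] a y C(2)[of u] by (auto simp: uw P_def)
      then show ?thesis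
        using arrow_in_image_space[of u w y] a by (simp add: uw P_def)
    next
      case False
      then have "w \<in> X" "rep_map R (u, w) y = 0"
        using X[of u w] a y kill[of u w y] by (simp_all add: uw P_def)
      then show ?thesis
        using subspace_0[OF C(1)] by (simp add: P_def)
    qed
    then show "rep_map R a ` P X (tail quiver_V2 a) \<subseteq> P X (head quiver_V2 a)"
      by (auto simp: uw)
  qed
  have "internal_direct_sum quiver_V2 V (P T) (P (- T))"
    unfolding internal_direct_sum_def
  proof (intro ballI conjI)
    fix u
    show "V u = {a + b |a b. a \<in> P T u \<and> b \<in> P (- T) u}"
    proof (cases "u \<in> T")
      case True
      have "{a + c |a c. a \<in> image_space u \<and> c \<in> C u} =
          {c + a |c a. c \<in> C u \<and> a \<in> image_space u}"
        by (auto; metis add.commute)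
      with True show ?thesis
        using C(3)[of u] by (simp add: P_def)
    next
      case False
      then show ?thesis
        using C(3)[of u] by (simp add: P_def)
    qed
    show "P T u \<inter> P (- T) u = {0}"
      using C(4)[of u] by (simp add: P_def Int_commute)
  qed
  moreover have "subrepresentation s quiver_V2 R (P T)" "subrepresentation s quiver_V2 R (P (- T))"
  proof -
    have alternate: "w \<in> T \<longleftrightarrow> u \<notin> T" if "(u, w) \<in> arcs quiver_V2" for u w
      using that T[of u] unfolding arcs_V2 by (elim disjE) simp_all
    show "subrepresentation s quiver_V2 R (P T)" "subrepresentation s quiver_V2 R (P (- T))"
      by (rule P_sub, use alternate in blast)+
  qed
  ultimately have "zero_family quiver_V2 (P T) \<or> zero_family quiver_V2 (P (- T))"
    using indec unfolding indecomposable_def by blast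
  moreover have "rep_map R (u, w) y = 0"
    if z: "zero_family quiver_V2 (P X)" "u \<in> X" and uw: "(u, w) \<in> arcs quiver_V2" "y \<in> V u"
    for X u w y
  proof -
    have "P X u = {0}"
      using z(1) by (simp add: zero_family_def)
    then have "C u = {0}"
      using z(2) by (simp add: P_def)
    then have "y \<in> image_space u"
      using C(3)[of u] uw(2) by auto
    then show ?thesis by (rule kill[OF uw(1)])
  qed
  ultimately show ?thesis by blast
qed

lemma diagonals_zero_imp_induced:
  assumes indec: "indecomposable s quiver_V2 R"
    and diag: "\<And>u y. y \<in> V u \<Longrightarrow>
      rep_map R (hflip u, hflip (vflip u)) (rep_map R (u, hflip u) y) = 0"
  shows "induced_by_indecomposable s quiver_A R \<or> induced_by_indecomposable s quiver_B R"
proof -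
  let ?S = "{V11, V22}"
  let ?A = "{(V11, V12), (V11, V21), (V22, V12), (V22, V21)}"
  let ?B = "{(V12, V11), (V12, V22), (V21, V11), (V21, V22)}"
  have AB: "(u, w) \<in> ?A \<longleftrightarrow> (u, w) \<in> arcs quiver_V2 \<and> u \<in> ?S"
    "(u, w) \<in> ?B \<longleftrightarrow> (u, w) \<in> arcs quiver_V2 \<and> u \<notin> ?S" for u w
    by (cases u; cases w; simp add: arcs_V2)+
  have "hflip u \<in> ?S \<longleftrightarrow> u \<notin> ?S" "vflip u \<in> ?S \<longleftrightarrow> u \<notin> ?S" for u
    by (cases u; simp)+
  from diagonals_zero_imp_half_vanishing[OF indec diag this] show ?thesis
  proof
    assume z: "\<forall>u w y. (u, w) \<in> arcs quiver_V2 \<longrightarrow> u \<in> ?S \<longrightarrow> y \<in> V u \<longrightarrow> rep_map R (u, w) y = 0"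
    have "induced_by_indecomposable s (quiver_of ?B) R"
    proof (rule induced_if_zero_outside[OF indec])
      show "?B \<subseteq> arcs quiver_V2"
        by (simp add: arcs_V2)
      fix u w y assume "(u, w) \<in> arcs quiver_V2 - ?B" "y \<in> V u"
      then show "rep_map R (u, w) y = 0"
        using z AB(2)[of u w] by blast
    qed
    then show ?thesis by (simp add: quiver_B_def)
  next
    assume z: "\<forall>u w y. (u, w) \<in> arcs quiver_V2 \<longrightarrow> u \<notin> ?S \<longrightarrow> y \<in> V u \<longrightarrow> rep_map R (u, w) y = 0"
    have "induced_by_indecomposable s (quiver_of ?A) R"
    proof (rule induced_if_zero_outside[OF indec])
      show "?A \<subseteq> arcs quiver_V2"
        by (simp add: arcs_V2)
      fix u w y assume "(u, w) \<in> arcs quiver_V2 - ?A" "y \<in> V u"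
      then show "rep_map R (u, w) y = 0"
        using z AB(1)[of u w] by blast
    qed
    then show ?thesis by (simp add: quiver_A_def)
  qed
qed

end

theorem lemma2p13:
  fixes s :: "complex \<Rightarrow> 'v::ab_group_add \<Rightarrow> 'v"
    and R :: "'v square_rep"
  assumes "V2_rep s R"
    and "indecomposable s quiver_V2 R"
  shows "(\<exists>k\<in>{1..4}. rep_iso quiver_V2 s R (*) (rho k)) \<or>
         induced_by_indecomposable s quiver_A R \<or>
         induced_by_indecomposable s quiver_B R"
proof -
  interpret V2_representation s R
    using assms(1) by unfold_locales
  show ?thesis
    using diagonal_nonzero_imp_iso_rho[OF assms(2)] diagonals_zero_imp_induced[OF assms(2)]
    by blast
qed

end
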